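(* Let $\{c_n\}_{n=1}^{\infty}$ be a sequence of complex numbers. Then for any $w\in\mathbb{C}$ and $p\in\mathbb{N}$ ($p\ge 1$) we have $$\sum_{k=1}^{p} w^{k-1} B_{p,k}^o\left(c_1,\ldots,c_{p-k+1}\right)=\det \left(\begin{matrix} c_1 & -1 & 0 & \ldots & 0 \\ c_2 & w c_1 & -1 & \ldots & 0 \\ c_3 & w c_2 & w c_1 & \ldots & 0 \\ \vdots & \vdots & \vdots & {} & \vdots \\ c_{p-1} & w c_{p-2} & w c_{p-3} & \ddots & -1 \\ c_p & w c_{p-1} & w c_{p-2} & \ldots & w c_1 \end{matrix}\right),$$ where the matrix is the $p\times p$ matrix whose first column is $(c_1,\ldots,c_p)^T$ and whose $(i,j)$ entry for $j\ge 2$ equals $w c_{i-j+1}$ if $i\ge j$, equals $-1$ if $i=j-1$, and equals $0$ if $i<j-1$.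
   Context: For $1\le k\le n$ the ordinary Bell polynomials are $$B^o_{n,k}(x_{1},x_{2},\dots ,x_{n-k+1})=k!\sum_{j \in I_k}\prod_{i=1}^{n-k+1} \frac{x_i^{j_{i}} }{j_{i}!},$$ where $I_k$ consists of all multi-indices $j=(j_1,\ldots,j_{n-k+1})$ of non-negative integers with $\sum_{i=1}^{n-k+1} i j_i=n$ and $\sum_{i=1}^{n-k+1} j_i=k$. The convention $w^0=1$ is used. *)

theory Defs
  imports
    Complex_Main
    "HOL-Library.FuncSet"
    "Jordan_Normal_Form.Determinant"
begin

text \<open>
  A multi-index $(j_1,\ldots,j_{n-k+1})$ is an extensional function on \<open>{1..n - k + 1}\<close>, so that
  each one is represented exactly once. Only \<open>1 \<le> k \<le> n\<close> is meaningful, because of the truncated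
  subtraction \<open>n - k\<close>.
\<close>

definition bell_indices :: "nat \<Rightarrow> nat \<Rightarrow> (nat \<Rightarrow> nat) set" where
  "bell_indices n k =
     {j \<in> {1..n - k + 1} \<rightarrow>\<^sub>E UNIV.
        (\<Sum>i = 1..n - k + 1. i * j i) = n \<and> (\<Sum>i = 1..n - k + 1. j i) = k}"

text \<open>The sum over \<open>bell_indices n k\<close> is a genuine finite sum:\<close>

lemma finite_bell_indices: "finite (bell_indices n k)"
proof (rule finite_subset)
  show "bell_indices n k \<subseteq> {1..n - k + 1} \<rightarrow>\<^sub>E {..k}"
  proof
    fix j assume j: "j \<in> bell_indices n k"
    have "j i \<le> k" if "i \<in> {1..n - k + 1}" for i
      using member_le_sum[of i "{1..n - k + 1}" j] that j by (simp add: bell_indices_def)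
    then show "j \<in> {1..n - k + 1} \<rightarrow>\<^sub>E {..k}"
      using j by (auto simp: bell_indices_def PiE_iff)
  qed
  show "finite ({1..n - k + 1} \<rightarrow>\<^sub>E {..k})"
    by (intro finite_PiE) auto
qed

text \<open>
  The arguments $x_1,\ldots,x_{n-k+1}$ are passed as a sequence \<open>x\<close>, of which only the values at
  indices in \<open>{1..n - k + 1}\<close> are used.
\<close>

definition ordinary_bell :: "nat \<Rightarrow> nat \<Rightarrow> (nat \<Rightarrow> 'a::field_char_0) \<Rightarrow> 'a" where
  "ordinary_bell n k x =
     fact k * (\<Sum>j\<in>bell_indices n k. \<Prod>i = 1..n - k + 1. x i ^ j i / fact (j i))"

text \<open>Rows and columns are numbered from \<open>1\<close> in \<open>bell_entry\<close>, whereas \<^const>\<open>mat\<close> numbers from \<open>0\<close>.\<close>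

definition bell_entry :: "'a::comm_ring_1 \<Rightarrow> (nat \<Rightarrow> 'a) \<Rightarrow> nat \<Rightarrow> nat \<Rightarrow> 'a" where
  "bell_entry w c i j =
     (if j = 1 then c i
      else if j \<le> i then w * c (i - j + 1)
      else if i = j - 1 then - 1
      else 0)"

definition bell_matrix :: "nat \<Rightarrow> 'a::comm_ring_1 \<Rightarrow> (nat \<Rightarrow> 'a) \<Rightarrow> 'a mat" where
  "bell_matrix p w c = mat p p (\<lambda>(i, j). bell_entry w c (i + 1) (j + 1))"

end

theory Submission
  imports Defs "HOL-Computational_Algebra.Formal_Power_Series"
begin

text \<open>
  Put \<open>f = c\<^sub>1 X + c\<^sub>2 X\<^sup>2 + \<dots>\<close>. The multinomial theorem says that the ordinary Bell polynomial of
  index \<open>(n, k)\<close> at \<open>c\<close> is the coefficient of \<open>X\<^sup>n\<close> in \<open>f\<^sup>k\<close>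
  (\<open>ordinary_bell_eq_fps_power_nth\<close>). The sum over \<open>k\<close> in the theorem is therefore the coefficient
  of \<open>X\<^sup>p\<close> in \<open>g = f + w f\<^sup>2 + w\<^sup>2 f\<^sup>3 + \<dots>\<close>, and the functional equation \<open>g = f + w f g\<close> of this
  geometric series is a recurrence for the coefficients of \<open>g\<close> (\<open>bell_sum_recurrence\<close>).

  On the other side, the matrix is lower Hessenberg with superdiagonal \<open>- 1\<close>. Expanding such a
  determinant along its last row expresses it through its smaller leading principal minors
  (\<open>det_hessenberg_Suc\<close>), and here this is the same recurrence, so strong induction on \<open>p\<close> closes
  the proof.
\<close>

section \<open>The multinomial theorem for power series\<close>

definition weighted_indices :: "nat set \<Rightarrow> nat \<Rightarrow> nat \<Rightarrow> (nat \<Rightarrow> nat) set" where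
  "weighted_indices I n k =
     {j \<in> I \<rightarrow>\<^sub>E UNIV. (\<Sum>i\<in>I. i * j i) = n \<and> (\<Sum>i\<in>I. j i) = k}"

definition index_sum :: "nat set \<Rightarrow> nat \<Rightarrow> nat \<Rightarrow> (nat \<Rightarrow> 'a::field_char_0) \<Rightarrow> 'a" where
  "index_sum I n k x = (\<Sum>j\<in>weighted_indices I n k. \<Prod>i\<in>I. x i ^ j i / fact (j i))"

definition supported_fps :: "nat set \<Rightarrow> (nat \<Rightarrow> 'a) \<Rightarrow> 'a::zero fps" where
  "supported_fps I x = Abs_fps (\<lambda>i. if i \<in> I then x i else 0)"

lemma supported_fps_nth: "fps_nth (supported_fps I x) i = (if i \<in> I then x i else 0)"
  by (simp add: supported_fps_def)

lemma finite_weighted_indices: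
  assumes "finite I"
  shows "finite (weighted_indices I n k)"
proof (rule finite_subset)
  show "weighted_indices I n k \<subseteq> I \<rightarrow>\<^sub>E {..k}"
  proof
    fix j assume j: "j \<in> weighted_indices I n k"
    have "j i \<le> k" if "i \<in> I" for i
      using member_le_sum[of i I j] that j assms by (simp add: weighted_indices_def)
    then show "j \<in> I \<rightarrow>\<^sub>E {..k}"
      using j by (auto simp: weighted_indices_def PiE_iff)
  qed
  show "finite (I \<rightarrow>\<^sub>E {..k})"
    using assms by (intro finite_PiE) auto
qed

lemma index_sum_0:
  assumes "finite I"
  shows "index_sum I n 0 x = (if n = 0 then 1 else 0)"
proof -
  have "weighted_indices I n 0 = (if n = 0 then {\<lambda>i\<in>I. 0} else {})"
    using assms by (auto simp: weighted_indices_def PiE_iff extensional_def fun_eq_iff)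
  then show ?thesis
    by (simp add: index_sum_def)
qed

text \<open>
  Lowering the exponent \<open>j i\<close> by one is a bijection from the multi-indices with \<open>j i > 0\<close> onto
  those of total degree one less, and \<open>j i / fact (j i) = 1 / fact (j i - 1)\<close>.
\<close>

lemma index_sum_marked:
  fixes x :: "nat \<Rightarrow> 'a::field_char_0"
  assumes I: "finite I" and i: "i \<in> I"
  shows "(\<Sum>j\<in>weighted_indices I n (Suc k). of_nat (j i) * (\<Prod>l\<in>I. x l ^ j l / fact (j l)))
       = (if i \<le> n then x i * index_sum I (n - i) k x else 0)"
proof -
  define t where "t j = (\<Prod>l\<in>I. x l ^ j l / fact (j l))" for j :: "nat \<Rightarrow> nat"
  define J where "J = {j \<in> weighted_indices I n (Suc k). 0 < j i}"
  have split_w: "(\<Sum>l\<in>I. l * j l) = i * j i + (\<Sum>l\<in>I - {i}. l * j l)" for j :: "nat \<Rightarrow> nat"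
    using I i by (rule sum.remove)
  have split_d: "(\<Sum>l\<in>I. j l) = j i + (\<Sum>l\<in>I - {i}. j l)" for j :: "nat \<Rightarrow> nat"
    using I i by (rule sum.remove)
  have split_t: "t j = x i ^ j i / fact (j i) * (\<Prod>l\<in>I - {i}. x l ^ j l / fact (j l))" for j
    unfolding t_def using I i by (rule prod.remove)
  have rest_w: "(\<Sum>l\<in>I - {i}. l * (j(i := m)) l) = (\<Sum>l\<in>I - {i}. l * j l)" for j m
    by (rule sum.cong) auto
  have rest_d: "(\<Sum>l\<in>I - {i}. (j(i := m)) l) = (\<Sum>l\<in>I - {i}. j l)" for j :: "nat \<Rightarrow> nat" and m
    by (rule sum.cong) auto
  have rest_t: "(\<Prod>l\<in>I - {i}. x l ^ (j(i := m)) l / fact ((j(i := m)) l))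
              = (\<Prod>l\<in>I - {i}. x l ^ j l / fact (j l))" for j m
    by (rule prod.cong) auto
  have "(\<Sum>j\<in>weighted_indices I n (Suc k). of_nat (j i) * t j) = (\<Sum>j\<in>J. of_nat (j i) * t j)"
    unfolding J_def using finite_weighted_indices[OF I]
    by (intro sum.mono_neutral_right) auto
  also have "\<dots> = (if i \<le> n then x i * index_sum I (n - i) k x else 0)"
  proof (cases "i \<le> n")
    case True
    have "(\<Sum>j\<in>J. of_nat (j i) * t j) = (\<Sum>j\<in>weighted_indices I (n - i) k. x i * t j)"
    proof (rule sum.reindex_bij_witness[where i = "\<lambda>j. j(i := Suc (j i))"
          and j = "\<lambda>j. j(i := j i - 1)"])
      fix j assume j: "j \<in> J"
      then obtain m where m: "j i = Suc m"
        by (auto simp: J_def gr0_conv_Suc)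
      show "(j(i := j i - 1))(i := Suc ((j(i := j i - 1)) i)) = j"
        using m by auto
      show "j(i := j i - 1) \<in> weighted_indices I (n - i) k"
        using j i m unfolding J_def weighted_indices_def split_w split_d rest_w rest_d
        by (auto simp: PiE_iff extensional_def)
      let ?r = "\<Prod>l\<in>I - {i}. x l ^ j l / fact (j l)"
      have "x i * (x i ^ m / fact m) * ?r = of_nat (Suc m) * (x i ^ Suc m / fact (Suc m)) * ?r"
        by (simp add: fact_Suc del: of_nat_Suc)
      then show "x i * t (j(i := j i - 1)) = of_nat (j i) * t j"
        unfolding split_t rest_t m by (simp only: fun_upd_same diff_Suc_1 mult.assoc)
    next
      fix j assume j: "j \<in> weighted_indices I (n - i) k"
      show "(j(i := Suc (j i)))(i := (j(i := Suc (j i))) i - 1) = j"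
        by simp
      show "j(i := Suc (j i)) \<in> J"
        using j i True unfolding J_def weighted_indices_def split_w split_d rest_w rest_d
        by (auto simp: PiE_iff extensional_def)
    qed
    then show ?thesis
      using True by (simp add: index_sum_def t_def sum_distrib_left)
  next
    case False
    have "i \<le> n" if "j \<in> J" for j
    proof -
      have "i * 1 \<le> i * j i"
        using that by (intro mult_le_mono) (auto simp: J_def)
      also have "\<dots> \<le> n"
        using that unfolding J_def weighted_indices_def split_w by auto
      finally show ?thesis by simp
    qed
    with False have "J = {}" by blast
    with False show ?thesis by simp
  qed
  finally show ?thesis unfolding t_def .
qed

text \<open>
  The left factor \<open>Suc k\<close> is \<open>\<Sum>i\<in>I. j i\<close> on every multi-index that occurs, so it distributes over
  the choices of a marked \<open>i\<close>.
\<close>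

lemma index_sum_Suc:
  fixes x :: "nat \<Rightarrow> 'a::field_char_0"
  assumes "finite I"
  shows "of_nat (Suc k) * index_sum I n (Suc k) x
       = (\<Sum>i\<in>I. if i \<le> n then x i * index_sum I (n - i) k x else 0)"
proof -
  let ?t = "\<lambda>j. \<Prod>l\<in>I. x l ^ j l / fact (j l)"
  have "of_nat (Suc k) * index_sum I n (Suc k) x
      = (\<Sum>j\<in>weighted_indices I n (Suc k). of_nat (\<Sum>i\<in>I. j i) * ?t j)"
    unfolding index_sum_def sum_distrib_left
    by (rule sum.cong) (auto simp: weighted_indices_def)
  also have "\<dots> = (\<Sum>j\<in>weighted_indices I n (Suc k). \<Sum>i\<in>I. of_nat (j i) * ?t j)"
    by (simp add: sum_distrib_right)
  also have "\<dots> = (\<Sum>i\<in>I. \<Sum>j\<in>weighted_indices I n (Suc k). of_nat (j i) * ?t j)"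
    by (rule sum.swap)
  also have "\<dots> = (\<Sum>i\<in>I. if i \<le> n then x i * index_sum I (n - i) k x else 0)"
    using assms by (intro sum.cong) (simp_all add: index_sum_marked)
  finally show ?thesis .
qed

text \<open>
  Both sides satisfy the same recurrence in \<open>k\<close>: multiplying by one more factor \<open>f\<close> is the
  convolution that \<open>index_sum_Suc\<close> describes.
\<close>

lemma multinomial_supported_fps:
  fixes x :: "nat \<Rightarrow> 'a::field_char_0"
  assumes "finite I"
  shows "fact k * index_sum I n k x = fps_nth (supported_fps I x ^ k) n"
proof (induction k arbitrary: n)
  case 0
  show ?case using assms by (simp add: index_sum_0)
next
  case (Suc k)
  have "fps_nth (supported_fps I x ^ Suc k) n
      = (\<Sum>i=0..n. if i \<in> I then x i * (fact k * index_sum I (n - i) k x) else 0)"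
    by (auto simp: fps_mult_nth supported_fps_nth Suc.IH intro!: sum.cong)
  also have "\<dots> = (\<Sum>i\<in>{0..n} \<inter> I. x i * (fact k * index_sum I (n - i) k x))"
    by (simp add: sum.inter_restrict)
  also have "\<dots> = (\<Sum>i\<in>I \<inter> {0..n}. x i * (fact k * index_sum I (n - i) k x))"
    by (simp add: Int_commute)
  also have "\<dots> = (\<Sum>i\<in>I. if i \<le> n then x i * (fact k * index_sum I (n - i) k x) else 0)"
    using assms by (simp add: sum.inter_restrict)
  also have "\<dots> = fact k * (\<Sum>i\<in>I. if i \<le> n then x i * index_sum I (n - i) k x else 0)"
    by (auto simp: sum_distrib_left intro!: sum.cong)
  also have "\<dots> = fact (Suc k) * index_sum I n (Suc k) x"
    unfolding index_sum_Suc[OF assms, symmetric] by (simp add: algebra_simps)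
  finally show ?case by simp
qed

section \<open>Bell polynomials as coefficients of powers\<close>

lemma fps_power_nth_cong:
  fixes f g :: "'a::comm_ring_1 fps"
  assumes "\<And>i. i \<le> n \<Longrightarrow> fps_nth f i = fps_nth g i"
  shows "fps_nth (f ^ k) n = fps_nth (g ^ k) n"
  using assms
proof (induction k arbitrary: n)
  case (Suc k)
  then show ?case
    by (auto simp: fps_mult_nth intro!: sum.cong)
qed simp

text \<open>
  A series without constant term is \<open>X\<close> times its shift, so the coefficient of \<open>X\<^sup>n\<close> in its \<open>k\<close>-th
  power involves only the coefficients up to index \<open>n - k + 1\<close>. This is why the Bell polynomial has
  exactly that many arguments.
\<close>

lemma ordinary_bell_eq_fps_power_nth:
  assumes "k \<le> n"
  shows "ordinary_bell n k x = fps_nth (supported_fps {1..} x ^ k) n"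
proof -
  define I where "I = {1..n - k + 1}"
  define shift where "shift A = Abs_fps (\<lambda>i. fps_nth (supported_fps A x) (Suc i))" for A
  have factor_X: "supported_fps A x = fps_X * shift A" if "0 \<notin> A" for A
    using that by (auto simp: fps_eq_iff shift_def supported_fps_nth fps_X_mult_nth)
  have power_nth: "fps_nth (supported_fps A x ^ k) n = fps_nth (shift A ^ k) (n - k)"
    if "0 \<notin> A" for A
    using assms by (simp add: factor_X[OF that] power_mult_distrib fps_X_power_mult_nth)
  have "ordinary_bell n k x = fact k * index_sum I n k x"
    by (simp add: ordinary_bell_def bell_indices_def index_sum_def weighted_indices_def I_def)
  also have "\<dots> = fps_nth (supported_fps I x ^ k) n"
    by (rule multinomial_supported_fps) (simp add: I_def)
  also have "\<dots> = fps_nth (shift I ^ k) (n - k)"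
    by (rule power_nth) (simp add: I_def)
  also have "\<dots> = fps_nth (shift {1..} ^ k) (n - k)"
    by (rule fps_power_nth_cong) (auto simp: shift_def supported_fps_nth I_def)
  also have "\<dots> = fps_nth (supported_fps {1..} x ^ k) n"
    by (rule power_nth[symmetric]) simp
  finally show ?thesis .
qed

section \<open>The recurrence for the Bell sums\<close>

definition bell_sum :: "'a::field_char_0 \<Rightarrow> (nat \<Rightarrow> 'a) \<Rightarrow> nat \<Rightarrow> 'a" where
  "bell_sum w c n = (\<Sum>k = 1..n. w ^ (k - 1) * ordinary_bell n k c)"

text \<open>
  Powers \<open>f\<^sup>k\<close> with \<open>k > n\<close> do not contribute to the coefficient of \<open>X\<^sup>n\<close>, so one geometric sum with
  \<open>N\<close> terms serves for all \<open>n \<le> N\<close>.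
\<close>

lemma bell_sum_eq_geometric_nth:
  assumes "n \<le> N"
  shows "bell_sum w c n
       = fps_nth (\<Sum>k<N. fps_const (w ^ k) * supported_fps {1..} c ^ Suc k) n"
proof -
  let ?f = "supported_fps {1..} c"
  have zero: "fps_nth (?f ^ k) n = 0" if "n < k" for k
    using that by (intro startsby_zero_power_prefix[rule_format]) (auto simp: supported_fps_nth)
  have "bell_sum w c n = (\<Sum>k = 1..n. w ^ (k - 1) * fps_nth (?f ^ k) n)"
    by (simp add: bell_sum_def ordinary_bell_eq_fps_power_nth)
  also have "\<dots> = (\<Sum>k<n. w ^ k * fps_nth (?f ^ Suc k) n)"
    by (rule sum.reindex_bij_witness[where i = Suc and j = "\<lambda>k. k - 1"]) auto
  also have "\<dots> = (\<Sum>k<N. w ^ k * fps_nth (?f ^ Suc k) n)"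
    using assms zero by (intro sum.mono_neutral_left) (auto simp del: power_Suc)
  finally show ?thesis
    by (simp add: fps_sum_nth del: power_Suc)
qed

text \<open>The coefficient of \<open>X\<^sup>n\<^sup>+\<^sup>1\<close> in the equation \<open>g = f + w f g\<close> for the geometric series \<open>g\<close>.\<close>

lemma bell_sum_recurrence:
  "bell_sum w c (Suc n) = c (Suc n) + w * (\<Sum>i = 1..n. c i * bell_sum w c (Suc n - i))"
proof -
  let ?f = "supported_fps {1..} c"
  define g where "g N = (\<Sum>k<N. fps_const (w ^ k) * ?f ^ Suc k)" for N
  let ?N = "Suc n"
  have g_nth: "fps_nth (g N) m = bell_sum w c m" if "m \<le> N" for m N
    unfolding g_def using that by (rule bell_sum_eq_geometric_nth[symmetric])
  have "g (Suc ?N) = ?f + fps_const w * (?f * g ?N)"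
    unfolding g_def sum.lessThan_Suc_shift[of _ ?N]
    by (simp add: sum_distrib_left mult_ac del: sum.lessThan_Suc flip: fps_const_mult)
  then have "fps_nth (g (Suc ?N)) ?N = c ?N + w * fps_nth (?f * g ?N) ?N"
    by (simp add: supported_fps_nth)
  also have "fps_nth (?f * g ?N) ?N = (\<Sum>i=0..?N. fps_nth ?f i * bell_sum w c (?N - i))"
    unfolding fps_mult_nth by (intro sum.cong refl) (simp add: g_nth)
  finally have "fps_nth (g (Suc ?N)) ?N
      = c ?N + w * (\<Sum>i=0..?N. fps_nth ?f i * bell_sum w c (?N - i))" .
  moreover have "bell_sum w c 0 = 0"
    by (simp add: bell_sum_def)
  (* the ends i = 0 and i = n + 1 of the convolution vanish: neither f nor g has a constant term *)
  then have "(\<Sum>i=0..?N. fps_nth ?f i * bell_sum w c (?N - i))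
      = (\<Sum>i = 1..n. c i * bell_sum w c (?N - i))"
    by (intro sum.mono_neutral_cong_right) (auto simp: supported_fps_nth not_le le_Suc_eq)
  ultimately show ?thesis
    by (simp add: g_nth)
qed

section \<open>Hessenberg determinants\<close>

text \<open>
  Deleting the last row and column \<open>j\<close> leaves a block lower triangular matrix: the leading
  \<open>j \<times> j\<close> minor, and a lower triangular block of size \<open>n - j\<close> with \<open>- 1\<close> on the diagonal, whose sign
  cancels that of the cofactor.
\<close>

lemma det_hessenberg_Suc:
  fixes a :: "nat \<Rightarrow> nat \<Rightarrow> 'a::idom"
  assumes superdiag: "\<And>i. a i (Suc i) = - 1"
    and zero: "\<And>i j. Suc i < j \<Longrightarrow> a i j = 0"
  shows "det (mat (Suc n) (Suc n) (\<lambda>(i, j). a i j))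
       = (\<Sum>j\<le>n. a n j * det (mat j j (\<lambda>(i, j). a i j)))"
proof -
  let ?A = "mat (Suc n) (Suc n) (\<lambda>(i, j). a i j)"
  have cofactor: "cofactor ?A n j = det (mat j j (\<lambda>(i, j). a i j))" if j: "j \<le> n" for j
  proof -
    let ?L = "mat j j (\<lambda>(i, j). a i j)"
    let ?C = "mat (n - j) j (\<lambda>(i, l). a (i + j) l)"
    let ?D = "mat (n - j) (n - j) (\<lambda>(i, l). a (i + j) (Suc (l + j)))"
    have "mat_delete ?A n j = four_block_mat ?L (0\<^sub>m j (n - j)) ?C ?D"
      using j by (intro eq_matI) (auto simp: mat_delete_def four_block_mat_def Let_def zero)
    then have "det (mat_delete ?A n j) = det ?L * det ?D"
      using det_four_block_mat_upper_right_zero[of ?L j "0\<^sub>m j (n - j)" "n - j" ?C ?D] by simp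
    moreover have "det ?D = prod_list (diag_mat ?D)"
      by (rule det_lower_triangular[of "n - j"]) (auto simp: zero)
    moreover have "\<dots> = (- 1) ^ (n - j)"
      by (simp add: prod_list_diag_prod superdiag)
    moreover have "(- 1) ^ (n + j) * (- 1) ^ (n - j) = (1 :: 'a)"
      using j by (simp flip: power_add)
    ultimately show ?thesis
      by (simp add: cofactor_def mult.left_commute)
  qed
  have "det ?A = (\<Sum>j<Suc n. ?A $$ (n, j) * cofactor ?A n j)"
    by (rule laplace_expansion_row) auto
  also have "\<dots> = (\<Sum>j\<le>n. a n j * det (mat j j (\<lambda>(i, j). a i j)))"
    unfolding lessThan_Suc_atMost by (intro sum.cong refl) (simp add: cofactor)
  finally show ?thesis .
qed

text \<open>
  The first column of the matrix lacks the factor \<open>w\<close>; it produces the inhomogeneous term, since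
  the empty leading minor has determinant \<open>1\<close>.
\<close>

lemma det_bell_matrix_recurrence:
  fixes w :: "'a::idom"
  shows "det (bell_matrix (Suc n) w c)
       = c (Suc n) + w * (\<Sum>i = 1..n. c i * det (bell_matrix (Suc n - i) w c))"
proof -
  let ?a = "\<lambda>i j. bell_entry w c (i + 1) (j + 1)"
  have "det (bell_matrix (Suc n) w c) = (\<Sum>j\<le>n. ?a n j * det (bell_matrix j w c))"
    unfolding bell_matrix_def by (rule det_hessenberg_Suc) (auto simp: bell_entry_def)
  also have "\<dots> = c (Suc n) + (\<Sum>j = 1..n. ?a n j * det (bell_matrix j w c))"
    by (simp add: atMost_atLeast0 sum.atLeast_Suc_atMost bell_entry_def bell_matrix_def)
  also have "(\<Sum>j = 1..n. ?a n j * det (bell_matrix j w c))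
      = (\<Sum>i = 1..n. w * (c i * det (bell_matrix (Suc n - i) w c)))"
    by (rule sum.reindex_bij_witness[where i = "\<lambda>i. Suc n - i" and j = "\<lambda>j. Suc n - j"])
      (auto simp: bell_entry_def Suc_diff_le)
  finally show ?thesis
    by (simp add: sum_distrib_left)
qed

section \<open>The determinant formula\<close>

theorem theorem3p1:
  fixes c :: "nat \<Rightarrow> complex" and w :: complex and p :: nat
  assumes "p \<ge> 1"
  shows "(\<Sum>k = 1..p. w ^ (k - 1) * ordinary_bell p k c) = Determinant.det (bell_matrix p w c)"
proof -
  have "bell_sum w c p = det (bell_matrix p w c)"
    using assms
  proof (induction p rule: less_induct)
    case (less p)
    then obtain n where p: "p = Suc n"
      by (cases p) auto
    have "bell_sum w c (Suc n - i) = det (bell_matrix (Suc n - i) w c)" if "i \<in> {1..n}" for i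
      using that p by (intro less.IH) auto
    then show ?case
      by (simp add: p bell_sum_recurrence det_bell_matrix_recurrence)
  qed
  then show ?thesis
    by (simp add: bell_sum_def)
qed

end
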